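(* Let $Q(z,\zeta_1,\zeta_2)$ be a function of three complex variables analytic in a neighborhood of the origin $\mathbf{0}=(0,0,0)$. Assume that $0$ is an $r$-fold zero ($1\le r<\infty$) of the function $Q(\cdot,0,0)$. Put $$\eta_j:=-\frac{r!\,\partial_{\zeta_j}Q(\mathbf{0})}{\partial_z^rQ(\mathbf{0})},\qquad j=1,2,$$ and assume that $\eta_1\neq0$, $\eta_2\neq0$ and $\arg\eta_2=\arg\eta_1+\xi_0\ (\mathrm{mod}\ 2\pi)$ with a certain $\xi_0\in(0,\pi)$. Then for small enough positive $\delta_1$ and $\delta_2$ there exists $\varepsilon>0$ such that $$\mathbb{D}_\varepsilon(0)\cap\mathrm{Sec}\left[\arg\sqrt[r]{\eta_1}+\delta_2,\ \arg\sqrt[r]{\eta_2}-\delta_2\right]\ \subset\ \Sigma_Q[T_{\delta_1}].$$ Here $\sqrt[r]{\zeta}$ and $\arg z$ are arbitrary branches of the corresponding multi-functions continuous on the infinite sectors $\mathrm{Sec}[\arg\eta_1,\arg\eta_1+\xi_0]$ and $\mathrm{Sec}[\arg\sqrt[r]{\eta_1},\arg\sqrt[r]{\eta_1}+\xi_0/r]$, respectively.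
   Context: $\mathbb{D}_\varepsilon(0)=\{z\in\mathbb{C}:|z|<\varepsilon\}$. For real $\xi_1\le\xi_2$, $\mathrm{Sec}[\xi_1,\xi_2]:=\{z\in\mathbb{C}\setminus\{0\}:\arg z=\xi\ (\mathrm{mod}\ 2\pi)\text{ for a certain }\xi\in[\xi_1,\xi_2]\}$ (the origin is excluded). For $\delta>0$, $T_\delta:=\{(\zeta_1,\zeta_2):\zeta_1,\zeta_2\in(0,+\infty),\ \zeta_1+\zeta_2<\delta\}$ (a real triangle viewed inside $\mathbb{C}^2$). For $\zeta=(\zeta_1,\zeta_2)\in\mathbb{C}^2$, $\Sigma_Q(\zeta)$ is the set of zeroes $z$ of $Q(\cdot,\zeta_1,\zeta_2)$ (in the domain of $Q$), and $\Sigma_Q[S]:=\bigcup_{\zeta\in S}\Sigma_Q(\zeta)$ for $S\subset\mathbb{C}^2$. *)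

theory Defs
  imports "HOL-Analysis.Analysis"
begin

text \<open>The library has no notion of analyticity in several complex variables, so it is defined
  here as local expandability into a power series on a polydisc.  The triple series is an
  unordered sum, i.e. it converges absolutely.\<close>

definition analytic3_at ::
  "(complex \<times> complex \<times> complex \<Rightarrow> complex) \<Rightarrow> complex \<times> complex \<times> complex \<Rightarrow> bool" where
  "analytic3_at f p \<longleftrightarrow>
     (\<exists>(c :: nat \<Rightarrow> nat \<Rightarrow> nat \<Rightarrow> complex) (R::real). R > 0 \<and>
        (\<forall>x y z. norm x < R \<and> norm y < R \<and> norm z < R \<longrightarrow>
           ((\<lambda>(i, j, k). c i j k * x ^ i * y ^ j * z ^ k) has_sum f (p + (x, y, z))) UNIV))"

definition analytic3_on ::
  "(complex \<times> complex \<times> complex \<Rightarrow> complex) \<Rightarrow> (complex \<times> complex \<times> complex) set \<Rightarrow> bool" where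
  "analytic3_on f U \<longleftrightarrow> (\<forall>p\<in>U. analytic3_at f p)"

text \<open>An \<open>r\<close>-fold zero; with \<open>r \<ge> 1\<close> the first condition includes \<open>f a = 0\<close>.\<close>

definition is_zero_of_mult :: "(complex \<Rightarrow> complex) \<Rightarrow> complex \<Rightarrow> nat \<Rightarrow> bool" where
  "is_zero_of_mult f a r \<longleftrightarrow>
     r \<ge> 1 \<and> (\<forall>k<r. (deriv ^^ k) f a = 0) \<and> (deriv ^^ r) f a \<noteq> 0"

text \<open>The library's \<^term>\<open>is_Arg z t\<close> says that \<open>t\<close> is one of the values of the multivalued
  argument of \<open>z\<close>; it holds for every \<open>t\<close> if \<open>z = 0\<close>, whence the exclusion of the origin.\<close>

definition Sec :: "real \<Rightarrow> real \<Rightarrow> complex set" where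
  "Sec \<xi>1 \<xi>2 = {z. z \<noteq> 0 \<and> (\<exists>\<xi>\<in>{\<xi>1..\<xi>2}. is_Arg z \<xi>)}"

definition is_root_branch_on :: "nat \<Rightarrow> (complex \<Rightarrow> complex) \<Rightarrow> complex set \<Rightarrow> bool" where
  "is_root_branch_on r \<rho> S \<longleftrightarrow> continuous_on S \<rho> \<and> (\<forall>w\<in>S. \<rho> w ^ r = w)"

definition is_arg_branch_on :: "(complex \<Rightarrow> real) \<Rightarrow> complex set \<Rightarrow> bool" where
  "is_arg_branch_on \<phi> S \<longleftrightarrow> continuous_on S \<phi> \<and> (\<forall>z\<in>S. is_Arg z (\<phi> z))"

definition real_triangle :: "real \<Rightarrow> (complex \<times> complex) set" where
  "real_triangle \<delta> = {(complex_of_real s, complex_of_real t) | s t. 0 < s \<and> 0 < t \<and> s + t < \<delta>}"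

text \<open>Zero sets of \<open>Q(\<cdot>, \<zeta>)\<close>, where \<open>U\<close> is the domain of \<open>Q\<close> (functions in HOL are total).\<close>

definition zero_set ::
  "(complex \<times> complex \<times> complex) set \<Rightarrow> (complex \<times> complex \<times> complex \<Rightarrow> complex)
    \<Rightarrow> complex \<times> complex \<Rightarrow> complex set" where
  "zero_set U Q \<zeta> = {z. (z, \<zeta>) \<in> U \<and> Q (z, \<zeta>) = 0}"

definition zero_set_over ::
  "(complex \<times> complex \<times> complex) set \<Rightarrow> (complex \<times> complex \<times> complex \<Rightarrow> complex)
    \<Rightarrow> (complex \<times> complex) set \<Rightarrow> complex set" where
  "zero_set_over U Q S = (\<Union>\<zeta>\<in>S. zero_set U Q \<zeta>)"

end

theory Submission
  imports Defs
begin

text \<open>Up to a nonzero factor, \<open>Q(z, \<zeta>\<^sub>1, \<zeta>\<^sub>2) = z\<^sup>r - \<eta>\<^sub>1 \<zeta>\<^sub>1 - \<eta>\<^sub>2 \<zeta>\<^sub>2 + E\<close>, where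
  \<open>E = O(\<bar>z\<bar>\<^bsup>r+1\<^esup>)\<close> as long as \<open>\<zeta>\<^sub>j = O(\<bar>z\<bar>\<^sup>r)\<close>. As \<open>\<eta>\<^sub>1, \<eta>\<^sub>2\<close> are linearly independent
  over the reals, every \<open>u\<close> equals \<open>\<eta>\<^sub>1 V\<^sub>1(u) + \<eta>\<^sub>2 V\<^sub>2(u)\<close> with real-linear \<open>V\<^sub>j\<close>, and
  \<open>Q = 0\<close> becomes the fixed point equation \<open>\<zeta> = V(z\<^sup>r + E(z, \<zeta>))\<close>. In the closed subsector,
  \<open>V\<^sub>1(z\<^sup>r)\<close> and \<open>V\<^sub>2(z\<^sup>r)\<close> are bounded below by a positive multiple \<open>m T\<close> of
  \<open>T = \<bar>z\<bar>\<^sup>r\<close>, so for small \<open>z\<close> the right-hand side maps the square \<open>[m T / 2, K T]\<^sup>2\<close> into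
  itself, and Brouwer's theorem yields a positive real solution \<open>\<zeta>\<close>.\<close>

section \<open>Expansion at the origin: coefficients, continuity and a weighted remainder\<close>

lemma has_sum_higher_deriv_0:
  fixes b :: "nat \<Rightarrow> complex"
  assumes "R > 0" and "\<And>x. norm x < R \<Longrightarrow> ((\<lambda>i. b i * x ^ i) has_sum f x) UNIV"
  shows "(deriv ^^ k) f 0 = fact k * b k"
proof -
  have "eventually (\<lambda>x. x \<in> ball (0::complex) R) (nhds 0)"
    using assms(1) by (intro eventually_nhds_in_open) auto
  then have "eventually (\<lambda>x. (\<lambda>i. fps_nth (Abs_fps b) i * x ^ i) sums f x) (nhds 0)"
    by eventually_elim (use assms(2) has_sum_imp_sums in auto)
  then have "f has_fps_expansion Abs_fps b"
    by (rule has_fps_expansionI)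
  from fps_nth_fps_expansion[OF this, of k] show ?thesis
    by (simp add: field_simps)
qed

context
  fixes Q :: "complex \<times> complex \<times> complex \<Rightarrow> complex"
    and c :: "nat \<Rightarrow> nat \<Rightarrow> nat \<Rightarrow> complex"
    and R :: real
  assumes R: "R > 0"
    and Q: "\<forall>x y z. norm x < R \<and> norm y < R \<and> norm z < R \<longrightarrow>
      ((\<lambda>(i, j, k). c i j k * x ^ i * y ^ j * z ^ k) has_sum Q (x, y, z)) UNIV"
begin

lemma expansion:
  assumes "norm x < R" "norm y < R" "norm z < R"
  shows "((\<lambda>(i, j, k). c i j k * x ^ i * y ^ j * z ^ k) has_sum Q (x, y, z)) UNIV"
  using Q assms by blast

text \<open>Setting two variables to zero kills every term off one coordinate axis of the index set,
  so the triple series collapses to a one-variable power series. The first equation, for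
  \<open>n \<le> r\<close>, translates the multiplicity of the zero; the other two, for
  \<open>n = 1\<close>, yield the partial derivatives in the parameters.\<close>

lemma higher_deriv_slice:
  shows "(deriv ^^ n) (\<lambda>x. Q (x, 0, 0)) 0 = fact n * c n 0 0"
    and "(deriv ^^ n) (\<lambda>y. Q (0, y, 0)) 0 = fact n * c 0 n 0"
    and "(deriv ^^ n) (\<lambda>z. Q (0, 0, z)) 0 = fact n * c 0 0 n"
proof -
  have slice: "((\<lambda>n. g (h n)) has_sum S) UNIV"
    if "(g has_sum S) UNIV" "inj h" "\<And>p. p \<notin> range h \<Longrightarrow> g p = 0"
    for g :: "nat \<times> nat \<times> nat \<Rightarrow> complex" and h :: "nat \<Rightarrow> nat \<times> nat \<times> nat" and S
  proof -
    have "(g has_sum S) (range h)"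
      using that(1,3) by (subst has_sum_cong_neutral[where T = UNIV and g = g]) auto
    then show ?thesis
      using has_sum_reindex[OF that(2), of g S] by (simp add: o_def)
  qed
  show "(deriv ^^ n) (\<lambda>x. Q (x, 0, 0)) 0 = fact n * c n 0 0"
  proof (rule has_sum_higher_deriv_0[OF R])
    fix x :: complex assume "norm x < R"
    from slice[OF expansion[OF this, of 0 0], of "\<lambda>i. (i, 0, 0)"] R
    show "((\<lambda>i. c i 0 0 * x ^ i) has_sum Q (x, 0, 0)) UNIV"
      by (fastforce simp: inj_on_def image_iff power_0_left)
  qed
  show "(deriv ^^ n) (\<lambda>y. Q (0, y, 0)) 0 = fact n * c 0 n 0"
  proof (rule has_sum_higher_deriv_0[OF R])
    fix x :: complex assume "norm x < R"
    from slice[OF expansion[of 0 x 0], of "\<lambda>i. (0, i, 0)"] R this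
    show "((\<lambda>i. c 0 i 0 * x ^ i) has_sum Q (0, x, 0)) UNIV"
      by (fastforce simp: inj_on_def image_iff power_0_left)
  qed
  show "(deriv ^^ n) (\<lambda>z. Q (0, 0, z)) 0 = fact n * c 0 0 n"
  proof (rule has_sum_higher_deriv_0[OF R])
    fix x :: complex assume "norm x < R"
    from slice[OF expansion[of 0 0 x], of "\<lambda>i. (0, 0, i)"] R this
    show "((\<lambda>i. c 0 0 i * x ^ i) has_sum Q (0, 0, x)) UNIV"
      by (fastforce simp: inj_on_def image_iff power_0_left)
  qed
qed

text \<open>Unordered complex sums converge absolutely, so evaluating the series at the real point
  \<open>(s, t, t)\<close> is enough. One radius \<open>t\<close> serves both parameters, which obey
  the same bound later on.\<close>

lemma abs_summable_polydisc:
  fixes s t :: real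
  assumes "0 \<le> s" "s < R" "0 \<le> t" "t < R"
  shows "(\<lambda>(i, j, k). norm (c i j k) * s ^ i * t ^ j * t ^ k) summable_on UNIV"
proof -
  have "(\<lambda>(i, j, k). c i j k * of_real s ^ i * of_real t ^ j * of_real t ^ k) summable_on UNIV"
    using expansion[of "of_real s" "of_real t" "of_real t"] assms has_sum_imp_summable by fastforce
  then have "(\<lambda>p. norm ((\<lambda>(i, j, k). c i j k * of_real s ^ i * of_real t ^ j * of_real t ^ k) p))
      summable_on UNIV"
    using summable_on_iff_abs_summable_on_complex by blast
  also have "(\<lambda>p. norm ((\<lambda>(i, j, k). c i j k * of_real s ^ i * of_real t ^ j * of_real t ^ k) p))
     = (\<lambda>(i, j, k). norm (c i j k) * s ^ i * t ^ j * t ^ k)"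
    using assms by (auto simp: norm_mult norm_power fun_eq_iff)
  finally show ?thesis .
qed

text \<open>The M-test gives uniform convergence in the last two variables. The first variable stays
  frozen because Brouwer's theorem is applied for each \<open>z\<close> separately.\<close>

lemma continuous_on_slice:
  assumes "norm x < R" "0 \<le> t" "t < R"
  shows "continuous_on (cball 0 t \<times> cball 0 t) (\<lambda>(y, z). Q (x, y, z))"
proof -
  let ?F = "\<lambda>(i, j, k) (y, z). c i j k * x ^ i * y ^ j * z ^ k"
  have "uniform_limit (cball 0 t \<times> cball 0 t) (\<lambda>X p. \<Sum>n\<in>X. ?F n p) (\<lambda>(y, z). Q (x, y, z))
      (finite_subsets_at_top UNIV)"
  proof (rule Weierstrass_m_test_general')
    show "(\<lambda>(i, j, k). norm (c i j k) * norm x ^ i * t ^ j * t ^ k) summable_on UNIV"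
      using assms by (intro abs_summable_polydisc) auto
  next
    fix n :: "nat \<times> nat \<times> nat" and p :: "complex \<times> complex"
    assume "p \<in> cball 0 t \<times> cball 0 t"
    then show "norm (?F n p) \<le> (\<lambda>(i, j, k). norm (c i j k) * norm x ^ i * t ^ j * t ^ k) n"
      using assms by (auto simp: norm_mult norm_power split: prod.splits
          intro!: mult_mono power_mono)
  next
    fix p :: "complex \<times> complex"
    assume "p \<in> cball 0 t \<times> cball 0 t"
    then show "((\<lambda>n. ?F n p) has_sum (\<lambda>(y, z). Q (x, y, z)) p) UNIV"
      using expansion[of x "fst p" "snd p"] assms by (cases p) (simp add: case_prod_unfold)
  qed
  then show ?thesis
    by (rule uniform_limit_theorem[rotated])
      (auto simp: split_beta intro!: always_eventually continuous_intros)
qed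

text \<open>Give \<open>x\<close> weight 1 and \<open>y\<close>, \<open>z\<close> weight \<open>r\<close>: every monomial other than
  \<open>x\<^sup>r\<close>, \<open>y\<close>, \<open>z\<close> that occurs in \<open>Q\<close> has weight at least \<open>r + 1\<close>.\<close>

lemma weighted_remainder_bound:
  assumes r: "1 \<le> r" and c0: "\<forall>k<r. c k 0 0 = 0" and K: "0 \<le> K"
  obtains \<tau> M where "0 < \<tau>" "\<tau> < R" "0 \<le> M" "K * \<tau> ^ r < R"
    "\<And>x y z. norm x \<le> \<tau> \<Longrightarrow> norm y \<le> K * norm x ^ r \<Longrightarrow> norm z \<le> K * norm x ^ r \<Longrightarrow>
       norm (Q (x, y, z) - (c r 0 0 * x ^ r + c 0 1 0 * y + c 0 0 1 * z)) \<le> M * norm x ^ Suc r"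
proof -
  \<comment> \<open>The denominator forces both \<open>\<tau> < R\<close> and
    \<open>K * \<tau> < R\<close>; with \<open>\<tau> \<le> 1\<close> and \<open>r \<ge> 1\<close>
    this keeps \<open>(\<tau>, \<sigma>, \<sigma>)\<close> inside the polydisc of
    convergence.\<close>
  define \<tau> where "\<tau> = min 1 (R / (2 * (K + 1)))"
  define \<sigma> where "\<sigma> = K * \<tau> ^ r"
  have \<tau>: "0 < \<tau>" "\<tau> \<le> 1" "\<tau> \<le> R / (2 * (K + 1))"
    using R K by (auto simp: \<tau>_def)
  have "\<tau> * (2 * (K + 1)) \<le> R"
    using \<tau>(3) K by (simp add: pos_le_divide_eq)
  moreover have "0 \<le> K * \<tau>"
    using \<tau> K by simp
  ultimately have "\<tau> < R" and K\<tau>: "K * \<tau> < R"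
    using \<tau> by (auto simp: algebra_simps)
  have "\<tau> ^ r \<le> \<tau> ^ 1"
    using r \<tau> by (intro power_decreasing) auto
  then have "\<sigma> \<le> K * \<tau>"
    using K by (auto simp: \<sigma>_def intro: mult_left_mono)
  with K\<tau> have \<sigma>: "0 \<le> \<sigma>" "\<sigma> < R"
    using K \<tau> by (auto simp: \<sigma>_def)
  define g where "g = (\<lambda>(i, j, k). norm (c i j k) * \<tau> ^ i * \<sigma> ^ j * \<sigma> ^ k)"
  define S :: "(nat \<times> nat \<times> nat) set" where "S = {(r, 0, 0), (0, 1, 0), (0, 0, 1)}"
  have "g summable_on UNIV"
    unfolding g_def using \<tau> \<open>\<tau> < R\<close> \<sigma> by (intro abs_summable_polydisc) auto
  then have "g summable_on (- S)"
    by (rule summable_on_subset_banach) auto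
  then obtain G where G: "(g has_sum G) (- S)"
    by (auto simp: summable_on_def)
  have g0: "g p \<ge> 0" for p
    using \<tau> \<sigma> by (auto simp: g_def split: prod.splits)
  have G0: "G \<ge> 0"
    using has_sum_nonneg[OF G] g0 by auto
  have main: "norm (Q (x, y, z) - (c r 0 0 * x ^ r + c 0 1 0 * y + c 0 0 1 * z))
      \<le> G / \<tau> ^ Suc r * norm x ^ Suc r"
    if x: "norm x \<le> \<tau>" and y: "norm y \<le> K * norm x ^ r" and z: "norm z \<le> K * norm x ^ r"
    for x y z
  proof -
    \<comment> \<open>Weighted scaling: \<open>x\<close> has size \<open>\<tau> * s\<close>, and
      \<open>y\<close>, \<open>z\<close> have size at most \<open>\<sigma> * s ^ r\<close>. A term
      of weight \<open>w\<close> is therefore at most \<open>s ^ w\<close> times its majorant in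
      \<open>g\<close>.\<close>
    define s where "s = norm x / \<tau>"
    have s: "0 \<le> s" "s \<le> 1" and xs: "norm x = \<tau> * s"
      using x \<tau> by (auto simp: s_def)
    have eq: "K * norm x ^ r = \<sigma> * s ^ r"
      by (simp add: xs \<sigma>_def power_mult_distrib)
    have "\<sigma> * s ^ r \<le> \<sigma>"
      using \<sigma> s by (simp add: mult_left_le power_le_one)
    then have lt: "norm x < R" "norm y < R" "norm z < R"
      using x y z \<open>\<tau> < R\<close> \<sigma> eq by auto
    let ?f = "\<lambda>(i, j, k). c i j k * x ^ i * y ^ j * z ^ k"
    have "(?f has_sum sum ?f S) S"
      by (rule has_sum_finite) (auto simp: S_def)
    also have "sum ?f S = c r 0 0 * x ^ r + c 0 1 0 * y + c 0 0 1 * z"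
      using r by (simp add: S_def)
    finally have "(?f has_sum (Q (x, y, z) - (c r 0 0 * x ^ r + c 0 1 0 * y + c 0 0 1 * z)))
        (UNIV - S)"
      by (intro has_sum_Diff expansion lt) auto
    then have fs: "(?f has_sum (Q (x, y, z) - (c r 0 0 * x ^ r + c 0 1 0 * y + c 0 0 1 * z))) (- S)"
      by (simp add: Compl_eq_Diff_UNIV)
    have gs: "((\<lambda>p. g p * s ^ Suc r) has_sum (G * s ^ Suc r)) (- S)"
      by (rule has_sum_cmult_left[OF G])
    have "norm (Q (x, y, z) - (c r 0 0 * x ^ r + c 0 1 0 * y + c 0 0 1 * z)) \<le> G * s ^ Suc r"
    proof (rule norm_infsum_le[OF fs gs])
      fix p assume p: "p \<in> - S"
      obtain i j k where ijk: "p = (i, j, k)"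
        by (cases p) auto
      show "norm (?f p) \<le> g p * s ^ Suc r"
      proof (cases "j = 0 \<and> k = 0 \<and> i < r")
        case True
        then show ?thesis
          using c0 g0[of p] s by (simp add: ijk)
      next
        case False
        \<comment> \<open>Outside \<open>S\<close>, and with the powers \<open>i < r\<close> set
          aside, a pure power of \<open>x\<close> has exponent above \<open>r\<close>, a monomial
          linear in \<open>y\<close>, \<open>z\<close> carries a factor \<open>x\<close>, and any
          other has weight at least \<open>2 * r\<close>.\<close>
        have "Suc r \<le> i + r * (j + k)"
        proof -
          consider "j + k = 0" "i > r" | "j + k = 1" "i \<ge> 1" | "j + k \<ge> 2"
            using False p by (fastforce simp: ijk S_def)
          then show ?thesis
          proof cases
            case 3
            then have "r * 2 \<le> r * (j + k)" by (intro mult_le_mono) auto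
            with r show ?thesis by linarith
          qed (use r in auto)
        qed
        then have sle: "s ^ (i + r * (j + k)) \<le> s ^ Suc r"
          using s by (intro power_decreasing) auto
        have "norm (?f p) = norm (c i j k) * norm x ^ i * norm y ^ j * norm z ^ k"
          by (simp add: ijk norm_mult norm_power)
        also have "\<dots> \<le> norm (c i j k) * (\<tau> * s) ^ i * (\<sigma> * s ^ r) ^ j * (\<sigma> * s ^ r) ^ k"
          using y[unfolded eq] z[unfolded eq] s \<tau> \<sigma> unfolding xs
          by (intro mult_mono power_mono order_refl mult_nonneg_nonneg) auto
        also have "\<dots> = g p * s ^ (i + r * (j + k))"
          by (simp add: g_def ijk power_mult_distrib power_add distrib_left mult_ac flip: power_mult)
        also have "\<dots> \<le> g p * s ^ Suc r"
          using sle g0 by (intro mult_left_mono) auto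
        finally show ?thesis .
      qed
    qed
    also have "G * s ^ Suc r = G / \<tau> ^ Suc r * norm x ^ Suc r"
      by (simp add: s_def power_divide)
    finally show ?thesis .
  qed
  show thesis
    by (rule that[OF \<tau>(1) \<open>\<tau> < R\<close> _ \<sigma>(2)[unfolded \<sigma>_def] main]) (use G0 \<tau> in auto)
qed

end

section \<open>Arguments, sectors and continuous branches on them\<close>

lemma is_Arg_iff_cis: "is_Arg z t \<longleftrightarrow> z = of_real (norm z) * cis t"
  by (simp add: is_Arg_def cis_conv_exp)

lemma is_ArgI: "0 \<le> m \<Longrightarrow> is_Arg (of_real m * cis t) t"
  by (simp add: is_Arg_iff_cis norm_mult)

lemma is_Arg_power: "is_Arg z t \<Longrightarrow> is_Arg (z ^ n) (real n * t)"
  unfolding is_Arg_iff_cis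
  by (metis Complex.DeMoivre norm_power of_real_power power_mult_distrib)

lemma is_Arg_cis_eq: "z \<noteq> 0 \<Longrightarrow> is_Arg z s \<Longrightarrow> is_Arg z t \<Longrightarrow> cis s = cis t"
  unfolding is_Arg_iff_cis by (metis mult_cancel_left norm_eq_zero of_real_eq_0_iff)

lemma is_Arg_cong: "cis s = cis t \<Longrightarrow> is_Arg z s \<longleftrightarrow> is_Arg z t"
  by (simp add: is_Arg_iff_cis)

text \<open>Interpolating the modulus linearly while the angle grows uniformly joins the two edges
  of the sector. Questions about continuous branches thus become questions about continuous
  functions on an interval.\<close>

lemma Sec_path:
  assumes "w1 \<noteq> 0" "w2 \<noteq> 0" "is_Arg w1 \<alpha>" "is_Arg w2 (\<alpha> + \<xi>)" "0 < \<xi>"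
  obtains m where "continuous_on {0..\<xi>} m" "\<And>t. t \<in> {0..\<xi>} \<Longrightarrow> 0 < m t"
    "\<And>t. t \<in> {0..\<xi>} \<Longrightarrow> of_real (m t) * cis (\<alpha> + t) \<in> Sec \<alpha> (\<alpha> + \<xi>)"
    "w1 = of_real (m 0) * cis \<alpha>" "w2 = of_real (m \<xi>) * cis (\<alpha> + \<xi>)"
proof -
  define m where "m t = (1 - t / \<xi>) * norm w1 + t / \<xi> * norm w2" for t
  have pos: "0 < m t" if "t \<in> {0..\<xi>}" for t
  proof (cases "t = 0")
    case False
    then have "0 < t / \<xi> * norm w2" "0 \<le> (1 - t / \<xi>) * norm w1"
      using that assms by auto
    then show ?thesis by (simp add: m_def)
  qed (use assms in \<open>simp add: m_def\<close>)
  show thesis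
  proof (rule that[of m])
    show "continuous_on {0..\<xi>} m"
      using assms unfolding m_def by (intro continuous_intros) auto
    show "of_real (m t) * cis (\<alpha> + t) \<in> Sec \<alpha> (\<alpha> + \<xi>)" if "t \<in> {0..\<xi>}" for t
      using pos[OF that] that is_ArgI[of "m t" "\<alpha> + t"]
      by (auto simp: Sec_def intro!: bexI[of _ "\<alpha> + t"])
    show "w1 = of_real (m 0) * cis \<alpha>" "w2 = of_real (m \<xi>) * cis (\<alpha> + \<xi>)"
      using assms by (auto simp: m_def is_Arg_iff_cis)
  qed (use pos in auto)
qed

text \<open>Along the path, the branch minus the explicit angle is continuous with values in the
  multiples of 2 pi, hence constant.\<close>

lemma is_arg_branch_on_rotate:
  assumes "is_arg_branch_on \<phi> (Sec \<alpha> (\<alpha> + \<xi>))" "0 < \<xi>"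
    and "w1 \<noteq> 0" "w2 \<noteq> 0" "is_Arg w1 \<alpha>" "is_Arg w2 (\<alpha> + \<xi>)"
  shows "\<phi> w2 = \<phi> w1 + \<xi>"
proof -
  obtain m where m: "continuous_on {0..\<xi>} m" "\<And>t. t \<in> {0..\<xi>} \<Longrightarrow> 0 < m t"
    "\<And>t. t \<in> {0..\<xi>} \<Longrightarrow> of_real (m t) * cis (\<alpha> + t) \<in> Sec \<alpha> (\<alpha> + \<xi>)"
    "w1 = of_real (m 0) * cis \<alpha>" "w2 = of_real (m \<xi>) * cis (\<alpha> + \<xi>)"
    using Sec_path[OF assms(3-6,2)] by metis
  define h where "h t = \<phi> (of_real (m t) * cis (\<alpha> + t)) - (\<alpha> + t)" for t
  have "continuous_on (Sec \<alpha> (\<alpha> + \<xi>)) \<phi>"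
    using assms(1) by (simp add: is_arg_branch_on_def)
  moreover have "continuous_on {0..\<xi>} (\<lambda>t. of_real (m t) * cis (\<alpha> + t))"
    by (intro continuous_intros m(1))
  ultimately have "continuous_on {0..\<xi>} (\<lambda>t. \<phi> (of_real (m t) * cis (\<alpha> + t)))"
    by (rule continuous_on_compose2) (use m(3) in blast)
  then have cont: "continuous_on {0..\<xi>} h"
    unfolding h_def by (intro continuous_on_diff continuous_on_add continuous_on_const continuous_on_id)
  have cis_h: "cis (h t) = 1" if "t \<in> {0..\<xi>}" for t
  proof -
    let ?w = "of_real (m t) * cis (\<alpha> + t)"
    have "is_Arg ?w (\<phi> ?w)"
      using assms(1) m(3)[OF that] by (simp add: is_arg_branch_on_def)
    then have "cis (\<phi> ?w) = cis (\<alpha> + t)"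
      using m(2)[OF that] is_ArgI[of "m t" "\<alpha> + t"] by (intro is_Arg_cis_eq[of ?w]) auto
    then show ?thesis
      unfolding h_def by (subst cis_divide[symmetric]) simp
  qed
  have "h constant_on {0..\<xi>}"
  proof (rule continuous_discrete_range_constant[OF _ cont])
    fix s assume s: "s \<in> {0..\<xi>}"
    \<comment> \<open>All values of \<open>h\<close> are arguments of 1, so distinct ones are at
      least 2 pi apart; this discreteness forces constancy.\<close>
    have "2 * pi \<le> norm (h t - h s)" if t: "t \<in> {0..\<xi>}" and "h t \<noteq> h s" for t
    proof (rule ccontr)
      assume "\<not> 2 * pi \<le> norm (h t - h s)"
      moreover have "is_Arg 1 (h t)" "is_Arg 1 (h s)"
        using cis_h s t by (auto simp: is_Arg_iff_cis)
      ultimately have "h t = h s"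
        by (intro is_Arg_eqI) auto
      with that show False by simp
    qed
    then show "\<exists>e>0. \<forall>t. t \<in> {0..\<xi>} \<and> h t \<noteq> h s \<longrightarrow> e \<le> norm (h t - h s)"
      by (intro exI[of _ "2 * pi"]) auto
  qed auto
  then have "h 0 = h \<xi>"
    using assms(2) unfolding constant_on_def by auto
  then show ?thesis
    by (simp add: h_def m(4,5))
qed

text \<open>Dividing the branch by an explicit continuous root along the path leaves a continuous
  function whose values are \<open>r\<close>-th roots of unity. Having finite range on an interval,
  it is constant, so the branch turns exactly as the explicit root does.\<close>

lemma is_root_branch_on_rotate:
  assumes "is_root_branch_on r \<rho> (Sec \<alpha> (\<alpha> + \<xi>))" "0 < \<xi>" "1 \<le> r"
    and "w1 \<noteq> 0" "w2 \<noteq> 0" "is_Arg w1 \<alpha>" "is_Arg w2 (\<alpha> + \<xi>)" "is_Arg (\<rho> w1) \<beta>"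
  shows "is_Arg (\<rho> w2) (\<beta> + \<xi> / real r)"
proof -
  obtain m where m: "continuous_on {0..\<xi>} m" "\<And>t. t \<in> {0..\<xi>} \<Longrightarrow> 0 < m t"
    "\<And>t. t \<in> {0..\<xi>} \<Longrightarrow> of_real (m t) * cis (\<alpha> + t) \<in> Sec \<alpha> (\<alpha> + \<xi>)"
    "w1 = of_real (m 0) * cis \<alpha>" "w2 = of_real (m \<xi>) * cis (\<alpha> + \<xi>)"
    using Sec_path[OF assms(4-7,2)] by metis
  define d where "d t = of_real (root r (m t)) * cis ((\<alpha> + t) / real r)" for t
  define h where "h t = \<rho> (of_real (m t) * cis (\<alpha> + t)) / d t" for t
  have dr: "d t ^ r = of_real (m t) * cis (\<alpha> + t)" and d0: "d t \<noteq> 0" if "t \<in> {0..\<xi>}" for t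
  proof -
    have "cis ((\<alpha> + t) / real r) ^ r = cis (\<alpha> + t)"
      using assms(3) by (simp add: Complex.DeMoivre)
    then show "d t ^ r = of_real (m t) * cis (\<alpha> + t)" "d t \<noteq> 0"
      using m(2)[OF that] assms(3)
      by (auto simp: d_def power_mult_distrib less_imp_le simp flip: of_real_power)
  qed
  have "continuous_on (Sec \<alpha> (\<alpha> + \<xi>)) \<rho>"
    using assms(1) by (simp add: is_root_branch_on_def)
  moreover have "continuous_on {0..\<xi>} (\<lambda>t. of_real (m t) * cis (\<alpha> + t))"
    by (intro continuous_intros m(1))
  ultimately have "continuous_on {0..\<xi>} (\<lambda>t. \<rho> (of_real (m t) * cis (\<alpha> + t)))"
    by (rule continuous_on_compose2) (use m(3) in blast)
  moreover have "continuous_on {0..\<xi>} d"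
    unfolding d_def using assms(3) by (intro continuous_intros m(1)) auto
  ultimately have cont: "continuous_on {0..\<xi>} h"
    unfolding h_def by (intro continuous_on_divide) (use d0 in auto)
  have "h t ^ r = 1" if "t \<in> {0..\<xi>}" for t
    using assms(1) m(2,3)[OF that] dr[OF that]
    by (auto simp: h_def is_root_branch_on_def power_divide)
  then have "h ` {0..\<xi>} \<subseteq> {z. z ^ r = 1}"
    by auto
  then have "finite (h ` {0..\<xi>})"
    by (rule finite_subset) (use assms(3) in auto)
  then have "h constant_on {0..\<xi>}"
    by (intro continuous_finite_range_constant cont) auto
  then have "h 0 = h \<xi>"
    using assms(2) unfolding constant_on_def by auto
  then have "\<rho> w1 * d \<xi> = \<rho> w2 * d 0"
    using d0[of 0] d0[of \<xi>] assms(2) by (simp add: h_def m(4,5) field_simps)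
  then have "\<rho> w2 = \<rho> w1 * d \<xi> / d 0"
    using d0[of 0] assms(2) by (simp add: field_simps)
  also have "\<dots> = of_real (norm (\<rho> w1) * root r (m \<xi>) / root r (m 0))
      * (cis \<beta> * cis ((\<alpha> + \<xi>) / real r) / cis (\<alpha> / real r))"
    using assms(8) by (simp add: d_def is_Arg_iff_cis)
  also have "cis \<beta> * cis ((\<alpha> + \<xi>) / real r) / cis (\<alpha> / real r) = cis (\<beta> + \<xi> / real r)"
    by (simp add: cis_mult cis_divide add_divide_distrib)
  finally show ?thesis
    using is_ArgI[of "norm (\<rho> w1) * root r (m \<xi>) / root r (m 0)"] m(2)[of 0] m(2)[of \<xi>] assms(2,3)
    by (metis atLeastAtMost_iff divide_nonneg_nonneg less_eq_real_def mult_nonneg_nonneg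
        norm_ge_zero real_root_ge_zero)
qed

section \<open>Covering a subsector by zeros: real coordinates and Brouwer's theorem\<close>

lemma sin_ge_sin_of_between:
  assumes "0 \<le> \<kappa>" "\<kappa> \<le> s" "s \<le> pi - \<kappa>"
  shows "sin \<kappa> \<le> sin s"
proof (cases "s \<le> pi / 2")
  case True
  then show ?thesis
    using assms by (intro sin_monotone_2pi_le) auto
next
  case False
  then have "sin \<kappa> \<le> sin (pi - s)"
    using assms by (intro sin_monotone_2pi_le) auto
  then show ?thesis by simp
qed

text \<open>Cramer's rule over the reals: \<open>D\<close> is the determinant of \<open>a\<close>,
  \<open>b\<close> as plane vectors, and the real coefficients are the coordinates of
  \<open>u\<close> in that basis.\<close>

lemma cramer_complex:
  fixes a b u :: complex
  defines "D \<equiv> Im (cnj a * b)"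
  assumes "D \<noteq> 0"
  shows "a * of_real (- Im (cnj b * u) / D) + b * of_real (Im (cnj a * u) / D) = u"
proof -
  have "a * of_real (- Im (cnj b * u)) + b * of_real (Im (cnj a * u)) = u * of_real D"
    by (simp add: D_def complex_eq_iff algebra_simps)
  then show ?thesis
    using assms(2) unfolding of_real_divide times_divide_eq_right add_divide_distrib[symmetric] by simp
qed

text \<open>Phrasing the sector by the angle \<open>s\<close> of \<open>z ^ r\<close> relative to
  \<open>\<eta>1\<close> frees the analytic argument from branches of the root. The margin
  \<open>\<kappa>\<close> is later taken as \<open>r\<close> times the margin in the
  \<open>z\<close> plane.\<close>

lemma sector_covered_by_zeros:
  fixes Q :: "complex \<times> complex \<times> complex \<Rightarrow> complex" and c :: "nat \<Rightarrow> nat \<Rightarrow> nat \<Rightarrow> complex"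
  assumes R: "R > 0"
    and Q: "\<forall>x y z. norm x < R \<and> norm y < R \<and> norm z < R \<longrightarrow>
      ((\<lambda>(i, j, k). c i j k * x ^ i * y ^ j * z ^ k) has_sum Q (x, y, z)) UNIV"
    and U: "open U" "(0, 0, 0) \<in> U"
    and r: "1 \<le> r" and c0: "\<forall>k<r. c k 0 0 = 0" and a: "c r 0 0 \<noteq> 0"
    and \<eta>: "c 0 1 0 = - c r 0 0 * \<eta>1" "c 0 0 1 = - c r 0 0 * \<eta>2" "\<eta>1 \<noteq> 0" "\<eta>2 \<noteq> 0"
    and \<xi>: "is_Arg \<eta>1 \<alpha>" "is_Arg \<eta>2 (\<alpha> + \<xi>)" "\<xi> < pi"
    and \<kappa>: "0 < \<kappa>" "2 * \<kappa> \<le> \<xi>" and \<delta>: "0 < \<delta>"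
  obtains \<epsilon> where "0 < \<epsilon>" "\<And>z s. norm z < \<epsilon> \<Longrightarrow> z \<noteq> 0 \<Longrightarrow> is_Arg (z ^ r) (\<alpha> + s) \<Longrightarrow>
      \<kappa> \<le> s \<Longrightarrow> s \<le> \<xi> - \<kappa> \<Longrightarrow> z \<in> zero_set_over U Q (real_triangle \<delta>)"
proof -
  define D where "D = Im (cnj \<eta>1 * \<eta>2)"
  define V1 where "V1 u = - Im (cnj \<eta>2 * u) / D" for u
  define V2 where "V2 u = Im (cnj \<eta>1 * u) / D" for u
  have cis1: "\<eta>1 = of_real (norm \<eta>1) * cis \<alpha>" and cis2: "\<eta>2 = of_real (norm \<eta>2) * cis (\<alpha> + \<xi>)"
    using \<xi> by (auto simp: is_Arg_iff_cis)
  \<comment> \<open>At angle \<open>\<alpha> + s\<close> the coordinates \<open>V1\<close>,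
    \<open>V2\<close> are proportional to \<open>sin (\<xi> - s)\<close> and \<open>sin s\<close>,
    which makes their positivity inside the sector visible.\<close>
  have Im1: "Im (cnj \<eta>1 * (of_real T * cis (\<alpha> + s))) = norm \<eta>1 * T * sin s" for T s
  proof -
    have "cnj \<eta>1 * (of_real T * cis (\<alpha> + s)) = of_real (norm \<eta>1 * T) * (cis (- \<alpha>) * cis (\<alpha> + s))"
      by (subst cis1) (simp add: cis_cnj del: cis_mult)
    also have "cis (- \<alpha>) * cis (\<alpha> + s) = cis s"
      by (simp add: cis_mult)
    finally have eq: "cnj \<eta>1 * (of_real T * cis (\<alpha> + s)) = of_real (norm \<eta>1 * T) * cis s" .
    show ?thesis
      unfolding eq by simp
  qed
  have Im2: "Im (cnj \<eta>2 * (of_real T * cis (\<alpha> + s))) = - (norm \<eta>2 * T * sin (\<xi> - s))" for T s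
  proof -
    have "cnj \<eta>2 * (of_real T * cis (\<alpha> + s)) = of_real (norm \<eta>2 * T) * (cis (- (\<alpha> + \<xi>)) * cis (\<alpha> + s))"
      by (subst cis2) (simp add: cis_cnj del: cis_mult)
    also have "cis (- (\<alpha> + \<xi>)) * cis (\<alpha> + s) = cis (- (\<xi> - s))"
      by (simp add: cis_mult)
    finally have eq: "cnj \<eta>2 * (of_real T * cis (\<alpha> + s)) = of_real (norm \<eta>2 * T) * cis (- (\<xi> - s))" .
    have "sin (- (\<xi> - s)) = - sin (\<xi> - s)"
      by (rule sin_minus)
    then show ?thesis
      unfolding eq by simp
  qed
  \<comment> \<open>Here \<open>0 < \<xi> < pi\<close> makes \<open>\<eta>1\<close>,
    \<open>\<eta>2\<close> a positively oriented real basis.\<close>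
  have "D = norm \<eta>1 * norm \<eta>2 * sin \<xi>"
    unfolding D_def using Im1[of "norm \<eta>2" \<xi>] cis2 by simp
  moreover have "sin \<xi> > 0"
    using \<kappa> \<xi> by (intro sin_gt_zero) auto
  ultimately have D: "D > 0"
    using \<eta> by simp
  have cramer: "\<eta>1 * of_real (V1 u) + \<eta>2 * of_real (V2 u) = u" for u
    using cramer_complex[of \<eta>1 \<eta>2 u] D by (simp add: V1_def V2_def D_def)
  have V1_lin: "V1 (x * \<eta>1 + y * \<eta>2 + u) = Re x + V1 u" if "x \<in> \<real>" "y \<in> \<real>" for x y u
    using that D by (auto simp: V1_def D_def Reals_def field_simps)
  have V2_lin: "V2 (x * \<eta>1 + y * \<eta>2 + u) = Re y + V2 u" if "x \<in> \<real>" "y \<in> \<real>" for x y u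
    using that D by (auto simp: V2_def D_def Reals_def field_simps)
  have V1_add: "V1 (u + v) = V1 u + V1 v" and V2_add: "V2 (u + v) = V2 u + V2 v" for u v
    by (simp_all add: V1_def V2_def algebra_simps add_divide_distrib diff_divide_distrib)
  define B where "B = (norm \<eta>1 + norm \<eta>2) / D"
  have B: "B > 0"
    using D \<eta> by (simp add: B_def add_pos_pos)
  have V1_le: "\<bar>V1 u\<bar> \<le> B * norm u" for u
  proof -
    have "\<bar>Im (cnj \<eta>2 * u)\<bar> \<le> norm \<eta>2 * norm u"
      using abs_Im_le_cmod[of "cnj \<eta>2 * u"] by (simp add: norm_mult)
    also have "\<dots> \<le> (norm \<eta>1 + norm \<eta>2) * norm u"
      by (simp add: mult_right_mono)
    finally show ?thesis
      using D by (simp add: V1_def B_def divide_right_mono abs_minus_commute)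
  qed
  have V2_le: "\<bar>V2 u\<bar> \<le> B * norm u" for u
  proof -
    have "\<bar>Im (cnj \<eta>1 * u)\<bar> \<le> norm \<eta>1 * norm u"
      using abs_Im_le_cmod[of "cnj \<eta>1 * u"] by (simp add: norm_mult)
    also have "\<dots> \<le> (norm \<eta>1 + norm \<eta>2) * norm u"
      by (simp add: mult_right_mono)
    finally show ?thesis
      using D by (simp add: V2_def B_def divide_right_mono)
  qed
  \<comment> \<open>Both \<open>s\<close> and \<open>\<xi> - s\<close> will lie between
    \<open>\<kappa>\<close> and \<open>pi - \<kappa>\<close>, where the sine is at least
    \<open>sin \<kappa>\<close>; the minimum lets one constant serve both coordinates.\<close>
  define m where "m = min (norm \<eta>1) (norm \<eta>2) * sin \<kappa> / D"
  have sin_\<kappa>: "0 < sin \<kappa>"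
    using \<kappa> \<xi> by (intro sin_gt_zero) auto
  then have m: "m > 0"
    using \<eta> D by (simp add: m_def)
  have V_ge: "m * T \<le> V1 (of_real T * cis (\<alpha> + s))" "m * T \<le> V2 (of_real T * cis (\<alpha> + s))"
    if "\<kappa> \<le> s" "s \<le> \<xi> - \<kappa>" "0 \<le> T" for T s
  proof -
    have "sin \<kappa> \<le> sin s" "sin \<kappa> \<le> sin (\<xi> - s)"
      using that \<kappa> \<xi> by (auto intro!: sin_ge_sin_of_between)
    then have "min (norm \<eta>1) (norm \<eta>2) * sin \<kappa> \<le> norm \<eta>1 * sin s"
      "min (norm \<eta>1) (norm \<eta>2) * sin \<kappa> \<le> norm \<eta>2 * sin (\<xi> - s)"
      using sin_\<kappa> by (auto intro!: mult_mono)
    then have "min (norm \<eta>1) (norm \<eta>2) * sin \<kappa> * T \<le> norm \<eta>1 * sin s * T"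
      "min (norm \<eta>1) (norm \<eta>2) * sin \<kappa> * T \<le> norm \<eta>2 * sin (\<xi> - s) * T"
      using that(3) by (auto intro: mult_right_mono)
    then show "m * T \<le> V1 (of_real T * cis (\<alpha> + s))" "m * T \<le> V2 (of_real T * cis (\<alpha> + s))"
      using D unfolding V1_def V2_def m_def Im1 Im2 minus_minus times_divide_eq_left
      by (simp_all add: divide_right_mono mult_ac)
  qed
  \<comment> \<open>The coordinates of \<open>z ^ r\<close> are at most \<open>B * T\<close> and the
    error adds at most \<open>m * T / 2\<close>, so \<open>K * T\<close> is a safe upper side for
    the square.\<close>
  define K where "K = B + m"
  have K: "K > 0"
    using B m by (simp add: K_def)
  obtain \<tau> M where \<tau>: "0 < \<tau>" "\<tau> < R" "0 \<le> M" "K * \<tau> ^ r < R"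
    and bound: "\<And>x y z. norm x \<le> \<tau> \<Longrightarrow> norm y \<le> K * norm x ^ r \<Longrightarrow> norm z \<le> K * norm x ^ r \<Longrightarrow>
       norm (Q (x, y, z) - (c r 0 0 * x ^ r + c 0 1 0 * y + c 0 0 1 * z)) \<le> M * norm x ^ Suc r"
    using weighted_remainder_bound[OF R Q r c0 less_imp_le[OF K]] by blast
  \<comment> \<open>The factor 3 leaves one share \<open>d\<close> to each component of the point
    \<open>(z, \<zeta>1, \<zeta>2)\<close>.\<close>
  obtain d where d: "d > 0" "ball (0, 0, 0) (3 * d) \<subseteq> U"
  proof -
    obtain e where "e > 0" "ball (0, 0, 0) e \<subseteq> U"
      using U open_contains_ball by blast
    then show ?thesis
      using that[of "e / 3"] by simp
  qed
  define N where "N = B * (M / norm (c r 0 0))"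
  have N: "N \<ge> 0"
    using B \<tau> by (simp add: N_def)
  \<comment> \<open>In order: \<open>1\<close> gives \<open>T \<le> norm z\<close>,
    \<open>\<tau>\<close> admits the remainder estimate, \<open>d\<close> and \<open>d / K\<close>
    keep the point in \<open>U\<close>, \<open>\<delta> / (2 * K)\<close> keeps the parameters in
    the triangle, and the last entry gives \<open>N * norm z \<le> m / 2\<close>, with
    \<open>N + 1\<close> avoiding division by zero.\<close>
  define \<epsilon> where "\<epsilon> = Min {1, \<tau>, d, d / K, \<delta> / (2 * K), m / (2 * (N + 1))}"
  have \<epsilon>: "0 < \<epsilon>" "\<epsilon> \<le> 1" "\<epsilon> \<le> \<tau>" "\<epsilon> \<le> d" "\<epsilon> \<le> d / K" "\<epsilon> \<le> \<delta> / (2 * K)" "\<epsilon> \<le> m / (2 * (N + 1))"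
    using \<tau> d K \<delta> m N by (auto simp: \<epsilon>_def)
  show thesis
  proof (rule that[OF \<epsilon>(1)])
    fix z s
    assume z: "norm z < \<epsilon>" "z \<noteq> 0" and arg: "is_Arg (z ^ r) (\<alpha> + s)" and s: "\<kappa> \<le> s" "s \<le> \<xi> - \<kappa>"
    define T where "T = norm z ^ r"
    have T: "T > 0"
      using z by (simp add: T_def)
    have "T \<le> norm z ^ 1"
      unfolding T_def using z \<epsilon> r by (intro power_decreasing) auto
    then have Tz: "T \<le> norm z" by simp
    have zr: "z ^ r = of_real T * cis (\<alpha> + s)"
      using arg by (simp add: is_Arg_iff_cis T_def norm_power)
    have KT: "K * T < d" "2 * (K * T) < \<delta>"
    proof -
      have "K * T < K * \<epsilon>"
        using Tz z K by simp
      moreover have "K * \<epsilon> \<le> d" "2 * (K * \<epsilon>) \<le> \<delta>"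
        using \<epsilon>(5,6) K by (simp_all add: field_simps)
      ultimately show "K * T < d" "2 * (K * T) < \<delta>"
        by linarith+
    qed
    have KR: "K * T < R"
    proof -
      have "T \<le> \<tau> ^ r"
        unfolding T_def using z \<epsilon> by (intro power_mono) auto
      then have "K * T \<le> K * \<tau> ^ r"
        using K by (intro mult_left_mono) auto
      with \<tau>(4) show ?thesis by simp
    qed
    have Nz: "N * norm z \<le> m / 2"
    proof -
      have "norm z * (2 * (N + 1)) \<le> \<epsilon> * (2 * (N + 1))"
        using z N by (intro mult_right_mono) auto
      also have "\<dots> \<le> m"
        using \<epsilon>(7) N by (simp add: pos_le_divide_eq)
      finally have "2 * (N * norm z) + 2 * norm z \<le> m"
        by (simp add: algebra_simps)
      then show ?thesis
        using norm_ge_zero[of z] by linarith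
    qed
    \<comment> \<open>The lower corner is half the lower bound for the coordinates of
      \<open>z ^ r\<close>, leaving the other half to the error. It is still positive, which keeps
      the parameters positive.\<close>
    define S where "S = cbox (m * T / 2, m * T / 2) (K * T, K * T)"
    define q where "q w = Q (z, of_real (fst w), of_real (snd w)) / c r 0 0" for w :: "real \<times> real"
    \<comment> \<open>At a fixed point of \<open>G\<close> both coordinates of \<open>q w\<close>
      vanish, hence \<open>q w = 0\<close>.\<close>
    define G where "G w = (fst w + V1 (q w), snd w + V2 (q w))" for w
    have S: "0 < fst w" "0 < snd w" "fst w \<le> K * T" "snd w \<le> K * T" if "w \<in> S" for w
      using that m T unfolding S_def
      by (cases w; force simp: cbox_Pair_eq intro: less_le_trans[of 0 "m * T / 2"])+
    \<comment> \<open>\<open>e\<close> is the deviation of the normalised \<open>Q\<close> from its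
      leading part. Moving the linear terms to the other side turns \<open>G w\<close> into the
      coordinates of \<open>z ^ r + e\<close>, whose size is under control.\<close>
    have G_eq: "G w = (V1 (z ^ r + e), V2 (z ^ r + e)) \<and> \<bar>V1 e\<bar> \<le> m * T / 2 \<and> \<bar>V2 e\<bar> \<le> m * T / 2"
      if w: "w \<in> S" and e: "e = q w - (z ^ r - of_real (fst w) * \<eta>1 - of_real (snd w) * \<eta>2)" for w e
    proof -
      have "c r 0 0 * e = Q (z, of_real (fst w), of_real (snd w))
          - (c r 0 0 * z ^ r + c 0 1 0 * of_real (fst w) + c 0 0 1 * of_real (snd w))"
        unfolding e q_def \<eta> using a by (simp add: field_simps)
      then have "norm (c r 0 0) * norm e \<le> M * norm z ^ Suc r"
        using bound[of z "of_real (fst w)" "of_real (snd w)"] S[OF w] z \<epsilon>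
        by (simp add: T_def flip: norm_mult)
      then have "norm e \<le> M / norm (c r 0 0) * (norm z * T)"
        using a by (simp add: field_simps T_def)
      then have "B * norm e \<le> B * (M / norm (c r 0 0) * (norm z * T))"
        using B by (intro mult_left_mono) auto
      also have "\<dots> = N * norm z * T"
        by (simp add: N_def)
      also have "\<dots> \<le> m / 2 * T"
        using Nz T by (intro mult_right_mono) auto
      finally have "\<bar>V1 e\<bar> \<le> m * T / 2" "\<bar>V2 e\<bar> \<le> m * T / 2"
        using V1_le[of e] V2_le[of e] by auto
      moreover have "z ^ r + e = of_real (fst w) * \<eta>1 + of_real (snd w) * \<eta>2 + q w"
        by (simp add: e)
      ultimately show ?thesis
        by (simp add: G_def V1_lin V2_lin)
    qed
    have "G \<in> S \<rightarrow> S"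
    proof
      fix w assume w: "w \<in> S"
      from G_eq[OF w refl] obtain e where e: "G w = (V1 (z ^ r + e), V2 (z ^ r + e))"
        "\<bar>V1 e\<bar> \<le> m * T / 2" "\<bar>V2 e\<bar> \<le> m * T / 2" by blast
      have "\<bar>V1 (z ^ r)\<bar> \<le> B * T" "\<bar>V2 (z ^ r)\<bar> \<le> B * T"
        using V1_le[of "z ^ r"] V2_le[of "z ^ r"] by (auto simp: T_def norm_power)
      moreover have "m * T \<le> V1 (z ^ r)" "m * T \<le> V2 (z ^ r)"
        using V_ge[OF s, of T] T by (auto simp: zr)
      moreover have "0 < m * T" using m T by simp
      ultimately show "G w \<in> S"
        using e by (auto simp: S_def cbox_Pair_eq K_def V1_add V2_add distrib_right)
    qed
    moreover have "continuous_on S G"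
    proof -
      let ?\<iota> = "\<lambda>w :: real \<times> real. (complex_of_real (fst w), complex_of_real (snd w))"
      have slice: "continuous_on (cball 0 (K * T) \<times> cball 0 (K * T)) (\<lambda>(y, u). Q (z, y, u))"
        by (rule continuous_on_slice[OF R Q]) (use z \<epsilon>(3) \<tau>(2) K T KR in auto)
      have \<iota>: "continuous_on S ?\<iota>"
        by (intro continuous_intros)
      have "?\<iota> ` S \<subseteq> cball 0 (K * T) \<times> cball 0 (K * T)"
      proof safe
        fix w assume "w \<in> S"
        from S[OF this] show "of_real (fst w) \<in> cball (0::complex) (K * T)"
          "of_real (snd w) \<in> cball (0::complex) (K * T)"
          by auto
      qed
      from continuous_on_compose2[OF slice \<iota> this]
      have "continuous_on S (\<lambda>w. Q (z, of_real (fst w), of_real (snd w)))"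
        by simp
      then have q: "continuous_on S q"
        unfolding q_def using a by (intro continuous_on_divide continuous_on_const) auto
      show ?thesis
        unfolding G_def V1_def V2_def using D by (intro continuous_intros q) auto
    qed
    moreover have "S \<noteq> {}"
    proof -
      have "m * T / 2 \<le> K * T"
        using m B T by (simp add: K_def distrib_right)
      then show ?thesis
        by (simp add: S_def cbox_Pair_eq)
    qed
    ultimately obtain w where w: "w \<in> S" "G w = w"
      using brouwer[of S G] unfolding S_def by (metis compact_cbox convex_box(1))
    then have "V1 (q w) = 0" "V2 (q w) = 0"
      by (auto simp: G_def prod_eq_iff)
    then have "q w = 0"
      using cramer[of "q w"] by simp
    then have "Q (z, of_real (fst w), of_real (snd w)) = 0"
      using a by (simp add: q_def)
    moreover have "(z, of_real (fst w), of_real (snd w)) \<in> U"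
    proof -
      have "norm (z, complex_of_real (fst w), complex_of_real (snd w)) \<le> norm z + (fst w + snd w)"
        using norm_Pair_le[of z "(complex_of_real (fst w), complex_of_real (snd w))"]
          norm_Pair_le[of "complex_of_real (fst w)" "complex_of_real (snd w)"] S[OF w(1)] by simp
      also have "\<dots> < 3 * d"
        using S[OF w(1)] z \<epsilon>(4) KT(1) by simp
      finally show ?thesis
        using d(2) by (auto simp: zero_prod_def[symmetric])
    qed
    moreover have "(of_real (fst w), of_real (snd w)) \<in> real_triangle \<delta>"
      using S[OF w(1)] KT(2) by (auto simp: real_triangle_def)
    ultimately show "z \<in> zero_set_over U Q (real_triangle \<delta>)"
      by (auto simp: zero_set_over_def zero_set_def)
  qed
qed

section \<open>From branches of root and argument to angles of \<open>z ^ r\<close>\<close>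

theorem lemma4p3:
  fixes Q :: "complex \<times> complex \<times> complex \<Rightarrow> complex"
    and U :: "(complex \<times> complex \<times> complex) set"
    and r :: nat
    and \<eta>1 \<eta>2 :: complex
    and \<xi>0 :: real
    and \<rho> :: "complex \<Rightarrow> complex"
    and \<phi> :: "complex \<Rightarrow> real"
  assumes "open U" and "(0, 0, 0) \<in> U" and "analytic3_on Q U"
    and "1 \<le> r" and "is_zero_of_mult (\<lambda>z. Q (z, 0, 0)) 0 r"
    and "\<eta>1 = - (fact r * deriv (\<lambda>w. Q (0, w, 0)) 0) / (deriv ^^ r) (\<lambda>z. Q (z, 0, 0)) 0"
    and "\<eta>2 = - (fact r * deriv (\<lambda>w. Q (0, 0, w)) 0) / (deriv ^^ r) (\<lambda>z. Q (z, 0, 0)) 0"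
    and "\<eta>1 \<noteq> 0" and "\<eta>2 \<noteq> 0"
    and "0 < \<xi>0" and "\<xi>0 < pi"
    and "is_Arg \<eta>2 (Arg \<eta>1 + \<xi>0)"
    and "is_root_branch_on r \<rho> (Sec (Arg \<eta>1) (Arg \<eta>1 + \<xi>0))"
    and "is_arg_branch_on \<phi> (Sec (Arg (\<rho> \<eta>1)) (Arg (\<rho> \<eta>1) + \<xi>0 / real r))"
  shows "\<exists>\<delta>0>0. \<forall>\<delta>1 \<delta>2. 0 < \<delta>1 \<and> \<delta>1 < \<delta>0 \<and> 0 < \<delta>2 \<and> \<delta>2 < \<delta>0 \<longrightarrow>
           (\<exists>\<epsilon>>0. ball 0 \<epsilon> \<inter> Sec (\<phi> (\<rho> \<eta>1) + \<delta>2) (\<phi> (\<rho> \<eta>2) - \<delta>2)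
                  \<subseteq> zero_set_over U Q (real_triangle \<delta>1))"
proof (rule exI[of _ 1], intro conjI allI impI)
  \<comment> \<open>The threshold 1 suffices because a \<open>\<delta>2\<close> too large for the
    opening \<open>\<xi>0 / r\<close> makes the sector empty; this is the second case at the
    end.\<close>
  fix \<delta>1 \<delta>2 :: real
  assume \<delta>: "0 < \<delta>1 \<and> \<delta>1 < 1 \<and> 0 < \<delta>2 \<and> \<delta>2 < 1"
  obtain c R where R: "R > 0" and Q: "\<forall>x y z. norm x < R \<and> norm y < R \<and> norm z < R \<longrightarrow>
      ((\<lambda>(i, j, k). c i j k * x ^ i * y ^ j * z ^ k) has_sum Q (x, y, z)) UNIV"
    using assms(2,3) unfolding analytic3_on_def analytic3_at_def by fastforce
  note deriv = higher_deriv_slice[OF R Q]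
  have c0: "\<forall>k<r. c k 0 0 = 0"
    using assms(5) by (auto simp: is_zero_of_mult_def deriv)
  have a: "c r 0 0 \<noteq> 0"
    using assms(5) by (auto simp: is_zero_of_mult_def deriv)
  \<comment> \<open>The factorial \<open>r!\<close> cancels the one in the \<open>r\<close>-th
    derivative, so each \<eta> is minus a ratio of Taylor coefficients.\<close>
  have \<eta>: "c 0 1 0 = - c r 0 0 * \<eta>1" "c 0 0 1 = - c r 0 0 * \<eta>2"
    using a deriv(2)[of 1] deriv(3)[of 1] by (simp_all add: assms(6,7) deriv)
  define \<beta> where "\<beta> = Arg (\<rho> \<eta>1)"
  have Arg1: "is_Arg \<eta>1 (Arg \<eta>1)"
    by (rule is_Arg_Arg) fact
  have "\<eta>1 \<in> Sec (Arg \<eta>1) (Arg \<eta>1 + \<xi>0)" "\<eta>2 \<in> Sec (Arg \<eta>1) (Arg \<eta>1 + \<xi>0)"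
    using assms(8-12) Arg1 by (auto simp: Sec_def)
  then have pow: "\<rho> \<eta>1 ^ r = \<eta>1" "\<rho> \<eta>2 ^ r = \<eta>2"
    using assms(13) by (auto simp: is_root_branch_on_def)
  then have nz: "\<rho> \<eta>1 \<noteq> 0" "\<rho> \<eta>2 \<noteq> 0"
    using assms(4,8,9) by (auto simp: power_0_left)
  have \<beta>: "is_Arg (\<rho> \<eta>1) \<beta>"
    unfolding \<beta>_def by (rule is_Arg_Arg) fact
  have \<beta>2: "is_Arg (\<rho> \<eta>2) (\<beta> + \<xi>0 / real r)"
    using is_root_branch_on_rotate[OF assms(13,10,4,8,9) Arg1 assms(12) \<beta>] .
  have \<phi>2: "\<phi> (\<rho> \<eta>2) = \<phi> (\<rho> \<eta>1) + \<xi>0 / real r"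
    using assms(4,10,14) by (intro is_arg_branch_on_rotate[OF _ _ nz \<beta> \<beta>2]) (auto simp: \<beta>_def)
  have "\<rho> \<eta>1 \<in> Sec \<beta> (\<beta> + \<xi>0 / real r)"
    using nz \<beta> assms(10) by (auto simp: Sec_def)
  then have "is_Arg (\<rho> \<eta>1) (\<phi> (\<rho> \<eta>1))"
    using assms(14) by (auto simp: is_arg_branch_on_def \<beta>_def)
  from is_Arg_power[OF this, of r] have arg_r: "is_Arg \<eta>1 (real r * \<phi> (\<rho> \<eta>1))"
    by (simp add: pow)
  \<comment> \<open>The sector is described through \<open>\<phi>\<close>, so this value, and not
    \<open>Arg \<eta>1\<close>, is the reference angle of \<open>\<eta>1\<close>. The two agree
    modulo 2 pi, which carries the hypothesis on \<open>\<eta>2\<close> over.\<close>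
  define \<alpha> where "\<alpha> = real r * \<phi> (\<rho> \<eta>1)"
  have "cis (Arg \<eta>1) = cis \<alpha>"
    using is_Arg_cis_eq[OF assms(8) Arg1 arg_r] by (simp add: \<alpha>_def)
  then have "cis (Arg \<eta>1 + \<xi>0) = cis (\<alpha> + \<xi>0)"
    by (simp flip: cis_mult)
  then have arg2: "is_Arg \<eta>2 (\<alpha> + \<xi>0)"
    using assms(12) is_Arg_cong by blast
  show "\<exists>\<epsilon>>0. ball 0 \<epsilon> \<inter> Sec (\<phi> (\<rho> \<eta>1) + \<delta>2) (\<phi> (\<rho> \<eta>2) - \<delta>2)
      \<subseteq> zero_set_over U Q (real_triangle \<delta>1)"
  proof (cases "2 * (real r * \<delta>2) \<le> \<xi>0")
    case True
    have "0 < real r * \<delta>2" "0 < \<delta>1"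
      using \<delta> assms(4) by auto
    from sector_covered_by_zeros[OF R Q assms(1,2,4) c0 a \<eta> assms(8,9) arg_r[folded \<alpha>_def] arg2
        assms(11) this(1) True this(2)]
    obtain \<epsilon> where \<epsilon>: "0 < \<epsilon>" "\<And>z s. norm z < \<epsilon> \<Longrightarrow> z \<noteq> 0 \<Longrightarrow> is_Arg (z ^ r) (\<alpha> + s) \<Longrightarrow>
      real r * \<delta>2 \<le> s \<Longrightarrow> s \<le> \<xi>0 - real r * \<delta>2 \<Longrightarrow> z \<in> zero_set_over U Q (real_triangle \<delta>1)"
      by metis
    have "z \<in> zero_set_over U Q (real_triangle \<delta>1)"
      if z: "norm z < \<epsilon>" "z \<in> Sec (\<phi> (\<rho> \<eta>1) + \<delta>2) (\<phi> (\<rho> \<eta>2) - \<delta>2)" for z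
    proof -
      obtain t where t: "z \<noteq> 0" "is_Arg z t" "\<phi> (\<rho> \<eta>1) + \<delta>2 \<le> t" "t \<le> \<phi> (\<rho> \<eta>2) - \<delta>2"
        using z(2) by (auto simp: Sec_def)
      \<comment> \<open>The power map multiplies angles by \<open>r\<close>: \<open>z ^ r\<close>
        has angle \<open>s = r * t - \<alpha>\<close> relative to \<open>\<eta>1\<close>, and the
        margin \<open>\<delta>2\<close> becomes \<open>r * \<delta>2\<close>.\<close>
      have "real r * (\<phi> (\<rho> \<eta>1) + \<delta>2) \<le> real r * t"
        "real r * t \<le> real r * (\<phi> (\<rho> \<eta>1) + \<xi>0 / real r - \<delta>2)"
        using t \<phi>2 by (auto intro!: mult_left_mono)
      then have "real r * \<delta>2 \<le> real r * t - \<alpha>" "real r * t - \<alpha> \<le> \<xi>0 - real r * \<delta>2"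
        using assms(4) by (auto simp: \<alpha>_def algebra_simps)
      then show ?thesis
        using is_Arg_power[OF t(2), of r] t(1) z(1) by (intro \<epsilon>(2)[of z "real r * t - \<alpha>"]) auto
    qed
    then show ?thesis
      using \<epsilon>(1) by (intro exI[of _ \<epsilon>]) auto
  next
    case False
    then have "\<xi>0 / real r < 2 * \<delta>2"
      using assms(4) by (simp add: divide_less_eq mult_ac)
    then have "Sec (\<phi> (\<rho> \<eta>1) + \<delta>2) (\<phi> (\<rho> \<eta>2) - \<delta>2) = {}"
      by (auto simp: Sec_def \<phi>2)
    then show ?thesis
      by (intro exI[of _ 1]) auto
  qed
qed simp

end
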